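(* Let $L=(\ell_{i,j})$ be a Latin square of order $n$, let $L_3(L,n)$ be its Latin square graph, and let $S$ be a subset of the vertex set of $L_3(L,n)$. Then the following statements are equivalent: (i) $S$ is a $3$-dominating set of $L_3(L,n)$ with cardinality $n$; (ii) $S$ is a $(1,3)$-independent dominating set of $L_3(L,n)$ with cardinality $n$; (iii) the entries $\{\ell_{i,j}\mid (i,j)\in S\}$ of $L$ in the cells of $S$ form a transversal in $L$.
   Context: A Latin square of order $n$ is an $n\times n$ array $L=(\ell_{i,j})$ with entries from $[n]=\{1,\dots,n\}$ such that no symbol appears twice in any row or column. A transversal in $L$ is a set of $n$ cells (entries) containing exactly one cell from each row, exactly one from each column, and exactly one cell of each symbol. The Latin square graph $L_3(L,n)$ has vertex set $\{(i,j)\mid 1\le i,j\le n\}$, and two distinct vertices $(i,j)$ and $(p,q)$ are adjacent iff $i=p$ or $j=q$ or $\ell_{i,j}=\ell_{p,q}$. A subset $S$ of the vertex set $V$ of a graph is $k$-dominating if every vertex in $V\setminus S$ has at least $k$ neighbours in $S$. A $(1,3)$-independent dominating set is a $3$-dominating set $S$ that is independent (the subgraph induced by $S$ has no edges, i.e. its maximum degree is at most $0$). *)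

theory Defs
  imports Graph_Theory.Graph_Theory
begin

text \<open>
  An array of order \<open>n\<close> is a function on index pairs, of which only the values on
  \<open>{1..n} \<times> {1..n}\<close> are relevant. The trivial order \<open>n = 0\<close> is not excluded.
\<close>

definition cells :: "nat \<Rightarrow> (nat \<times> nat) set" where
  "cells n = {1..n} \<times> {1..n}"

definition latin_square :: "nat \<Rightarrow> (nat \<Rightarrow> nat \<Rightarrow> nat) \<Rightarrow> bool" where
  "latin_square n L \<longleftrightarrow>
     (\<forall>i\<in>{1..n}. \<forall>j\<in>{1..n}. L i j \<in> {1..n}) \<and>
     (\<forall>i\<in>{1..n}. inj_on (\<lambda>j. L i j) {1..n}) \<and>
     (\<forall>j\<in>{1..n}. inj_on (\<lambda>i. L i j) {1..n})"

definition transversal :: "nat \<Rightarrow> (nat \<Rightarrow> nat \<Rightarrow> nat) \<Rightarrow> (nat \<times> nat) set \<Rightarrow> bool" where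
  "transversal n L T \<longleftrightarrow>
     T \<subseteq> cells n \<and> card T = n \<and>
     (\<forall>i\<in>{1..n}. \<exists>!c. c \<in> T \<and> fst c = i) \<and>
     (\<forall>j\<in>{1..n}. \<exists>!c. c \<in> T \<and> snd c = j) \<and>
     (\<forall>s\<in>{1..n}. \<exists>!c. c \<in> T \<and> L (fst c) (snd c) = s)"

text \<open>
  Simple graphs are represented as in the locale \<^locale>\<open>pair_graph\<close>: finite, loop-free, with
  every edge present as a pair of opposite arcs.
\<close>

definition latin_square_graph ::
    "(nat \<Rightarrow> nat \<Rightarrow> nat) \<Rightarrow> nat \<Rightarrow> (nat \<times> nat) pair_pre_digraph" where
  "latin_square_graph L n =
     \<lparr> pverts = cells n,
       parcs = {((i, j), (p, q)) | i j p q.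
                  (i, j) \<in> cells n \<and> (p, q) \<in> cells n \<and> (i, j) \<noteq> (p, q) \<and>
                  (i = p \<or> j = q \<or> L i j = L p q)} \<rparr>"

lemma pair_graph_latin_square_graph: "pair_graph (latin_square_graph L n)"
proof
  let ?G = "latin_square_graph L n"
  have sub: "parcs ?G \<subseteq> cells n \<times> cells n"
    by (auto simp: latin_square_graph_def)
  have fin: "finite (cells n)"
    by (simp add: cells_def)
  show "finite (pverts ?G)"
    using fin by (simp add: latin_square_graph_def)
  show "finite (parcs ?G)"
    using sub fin by (meson finite_SigmaI finite_subset)
  show "symmetric (with_proj ?G)"
    by (auto simp: symmetric_def sym_def latin_square_graph_def)
qed (auto simp: latin_square_graph_def)

definition k_dominating :: "nat \<Rightarrow> 'a pair_pre_digraph \<Rightarrow> 'a set \<Rightarrow> bool" where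
  "k_dominating k G S \<longleftrightarrow>
     S \<subseteq> pverts G \<and> (\<forall>v \<in> pverts G - S. k \<le> card {u \<in> S. (v, u) \<in> parcs G})"

definition independent_set :: "'a pair_pre_digraph \<Rightarrow> 'a set \<Rightarrow> bool" where
  "independent_set G S \<longleftrightarrow> S \<subseteq> pverts G \<and> arcs (with_proj G \<restriction> S) = {}"

text \<open>The \<open>(1,k)\<close>-independent dominating sets.\<close>

definition one_k_independent_dominating :: "nat \<Rightarrow> 'a pair_pre_digraph \<Rightarrow> 'a set \<Rightarrow> bool" where
  "one_k_independent_dominating k G S \<longleftrightarrow> k_dominating k G S \<and> independent_set G S"

end

theory Submission
  imports Defs
begin

text \<open>
  For a cell \<open>v\<close> let \<open>r\<close>, \<open>c\<close>, \<open>s\<close> be the numbers of cells of \<open>S\<close> sharing the row, the column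
  and the symbol of \<open>v\<close>. If \<open>v \<notin> S\<close> then \<open>v\<close> has exactly \<open>r + c + s\<close> neighbours in \<open>S\<close>, and if
  \<open>v \<in> S\<close> then all three numbers are positive; so 3-domination gives \<open>r + c + s \<ge> 3\<close> on all cells.
  Summed over the \<open>n\<^sup>2\<close> cells, \<open>r + c + s\<close> gives \<open>3 n |S| = 3 n\<^sup>2\<close>, which forces equality
  everywhere. Hence \<open>r = c = s = 1\<close> on \<open>S\<close>, so the cells of \<open>S\<close> have distinct rows, columns and
  symbols, and there are \<open>n\<close> of them.
\<close>

abbreviation entry :: "(nat \<Rightarrow> nat \<Rightarrow> nat) \<Rightarrow> nat \<times> nat \<Rightarrow> nat" where
  "entry L c \<equiv> L (fst c) (snd c)"

abbreviation fibre :: "'a set \<Rightarrow> ('a \<Rightarrow> 'b) \<Rightarrow> 'b \<Rightarrow> 'a set" where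
  "fibre S f x \<equiv> {u \<in> S. f u = x}"

lemma finite_cells: "finite (cells n)"
  by (simp add: cells_def)

lemma card_cells: "card (cells n) = n * n"
  by (simp add: cells_def)

lemma pverts_latin_square_graph [simp]: "pverts (latin_square_graph L n) = cells n"
  by (simp add: latin_square_graph_def)

lemma arc_latin_square_graph_iff:
  "(u, v) \<in> parcs (latin_square_graph L n) \<longleftrightarrow> u \<in> cells n \<and> v \<in> cells n \<and> u \<noteq> v \<and>
    (fst u = fst v \<or> snd u = snd v \<or> entry L u = entry L v)"
  by (cases u; cases v) (simp add: latin_square_graph_def)

section \<open>Injectivity and double counting through fibres\<close>

text \<open>Since \<open>S\<close> and \<open>B\<close> are finite of equal size, an injective map
  from \<open>S\<close> into \<open>B\<close> is onto. This turns each clause of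
  \<open>transversal\<close> into injectivity of one coordinate.\<close>

lemma inj_on_iff_ex1_fibre:
  assumes "finite S" "finite B" "card S = card B" "f ` S \<subseteq> B"
  shows "inj_on f S \<longleftrightarrow> (\<forall>x\<in>B. \<exists>!u. u \<in> S \<and> f u = x)"
proof
  assume inj: "inj_on f S"
  then have "f ` S = B"
    using assms by (simp add: card_image card_subset_eq)
  then show "\<forall>x\<in>B. \<exists>!u. u \<in> S \<and> f u = x"
    using inj by (auto simp: inj_on_def)
next
  assume "\<forall>x\<in>B. \<exists>!u. u \<in> S \<and> f u = x"
  then show "inj_on f S"
    using assms(4) by (intro inj_onI) blast
qed

lemma inj_on_iff_card_fibre:
  assumes "finite S"
  shows "inj_on f S \<longleftrightarrow> (\<forall>v\<in>S. card (fibre S f (f v)) = 1)"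
proof
  assume "inj_on f S"
  then have "fibre S f (f v) = {v}" if "v \<in> S" for v
    using that by (auto simp: inj_on_def)
  then show "\<forall>v\<in>S. card (fibre S f (f v)) = 1"
    by simp
next
  assume one: "\<forall>v\<in>S. card (fibre S f (f v)) = 1"
  show "inj_on f S"
  proof (rule inj_onI)
    fix u v assume "u \<in> S" "v \<in> S" "f u = f v"
    moreover obtain w where "fibre S f (f v) = {w}"
      using one \<open>v \<in> S\<close> by (meson card_1_singletonE)
    ultimately have "u \<in> {w}" "v \<in> {w}" by blast+
    then show "u = v" by simp
  qed
qed

lemma card_fibre_pos:
  assumes "finite S" "v \<in> S"
  shows "card (fibre S f (f v)) \<ge> 1"
  using assms by (auto simp: Suc_le_eq card_gt_0_iff)

text \<open>Double counting of the pairs \<open>(v, u)\<close> in \<open>C \<times> S\<close> with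
  \<open>f v = f u\<close>: each \<open>u\<close> occurs once for every \<open>v\<close> in its
  fibre in \<open>C\<close>, that is, \<open>m\<close> times.\<close>

lemma sum_card_fibre:
  assumes "finite C" "S \<subseteq> C" "\<And>u. u \<in> S \<Longrightarrow> card (fibre C f (f u)) = m"
  shows "(\<Sum>v\<in>C. card (fibre S f (f v))) = m * card S"
proof -
  have "finite S" using assms finite_subset by blast
  then have "(\<Sum>v\<in>C. card (fibre S f (f v))) = (\<Sum>u\<in>S. m)"
    using assms by (intro sum_multicount_gen) (auto simp: eq_commute)
  then show ?thesis by (simp add: mult.commute)
qed

section \<open>Row, column and symbol classes of cells\<close>

lemma card_fst_fibre: "i \<in> {1..n} \<Longrightarrow> card (fibre (cells n) fst i) = n"
proof -
  assume "i \<in> {1..n}"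
  then have "fibre (cells n) fst i = {i} \<times> {1..n}" by (auto simp: cells_def)
  then show ?thesis by (simp add: card_cartesian_product)
qed

lemma card_snd_fibre: "j \<in> {1..n} \<Longrightarrow> card (fibre (cells n) snd j) = n"
proof -
  assume "j \<in> {1..n}"
  then have "fibre (cells n) snd j = {1..n} \<times> {j}" by (auto simp: cells_def)
  then show ?thesis by (simp add: card_cartesian_product)
qed

context
  fixes n :: nat and L :: "nat \<Rightarrow> nat \<Rightarrow> nat"
  assumes latin: "latin_square n L"
begin

lemma entry_in_range: "c \<in> cells n \<Longrightarrow> entry L c \<in> {1..n}"
  using latin by (auto simp: latin_square_def cells_def)

lemma eq_if_row_entry_eq:
  assumes "u \<in> cells n" "v \<in> cells n" "fst u = fst v" "entry L u = entry L v"
  shows "u = v"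
proof -
  have "inj_on (\<lambda>j. L (fst u) j) {1..n}"
    using latin assms(1) unfolding latin_square_def cells_def by (metis mem_Times_iff)
  moreover have "snd u \<in> {1..n}" "snd v \<in> {1..n}"
    using assms(1,2) by (simp_all add: cells_def mem_Times_iff)
  ultimately have "snd u = snd v"
    using assms(3,4) by (metis inj_onD)
  then show ?thesis
    using assms(3) by (simp add: prod_eq_iff)
qed

lemma eq_if_column_entry_eq:
  assumes "u \<in> cells n" "v \<in> cells n" "snd u = snd v" "entry L u = entry L v"
  shows "u = v"
proof -
  have "inj_on (\<lambda>i. L i (snd u)) {1..n}"
    using latin assms(1) unfolding latin_square_def cells_def by (metis mem_Times_iff)
  moreover have "fst u \<in> {1..n}" "fst v \<in> {1..n}"
    using assms(1,2) by (simp_all add: cells_def mem_Times_iff)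
  ultimately have "fst u = fst v"
    using assms(3,4) by (metis inj_onD)
  then show ?thesis
    using assms(3) by (simp add: prod_eq_iff)
qed

text \<open>An injective row is a permutation of \<open>{1..n}\<close>, so \<open>s\<close> occurs
  exactly once in each row, and \<open>fst\<close> maps the cells with symbol \<open>s\<close>
  bijectively onto the rows.\<close>

lemma card_entry_fibre:
  assumes "s \<in> {1..n}"
  shows "card (fibre (cells n) (entry L) s) = n"
proof -
  have "fst ` fibre (cells n) (entry L) s = {1..n}"
  proof (intro equalityI subsetI)
    fix i assume i: "i \<in> {1..n}"
    then have "L i ` {1..n} = {1..n}"
      using latin by (intro endo_inj_surj) (auto simp: latin_square_def)
    then obtain j where "j \<in> {1..n}" "L i j = s"
      using assms by (metis imageE)
    then show "i \<in> fst ` fibre (cells n) (entry L) s"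
      using i by (force simp: cells_def)
  qed (auto simp: cells_def)
  moreover have "inj_on fst (fibre (cells n) (entry L) s)"
    using eq_if_row_entry_eq by (intro inj_onI) auto
  ultimately show ?thesis
    using card_image by fastforce
qed

text \<open>A cell that agrees with \<open>v\<close> in two of row, column and symbol equals
  \<open>v\<close>. As \<open>v\<close> is outside \<open>S\<close>, the three fibres are therefore
  pairwise disjoint and their sizes add up.\<close>

lemma card_neighbours:
  assumes "S \<subseteq> cells n" "v \<in> cells n - S"
  shows "card {u \<in> S. (v, u) \<in> parcs (latin_square_graph L n)} =
    card (fibre S fst (fst v)) + card (fibre S snd (snd v)) + card (fibre S (entry L) (entry L v))"
proof -
  let ?R = "fibre S fst (fst v)" and ?C = "fibre S snd (snd v)"
    and ?E = "fibre S (entry L) (entry L v)"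
  have "finite S"
    using assms(1) finite_cells finite_subset by blast
  moreover have "{u \<in> S. (v, u) \<in> parcs (latin_square_graph L n)} = ?R \<union> ?C \<union> ?E"
    using assms by (auto simp: arc_latin_square_graph_iff)
  moreover have "?R \<inter> ?C = {}"
    using assms(2) by (auto simp: prod_eq_iff)
  moreover have "(?R \<union> ?C) \<inter> ?E = {}"
  proof (intro equals0I)
    fix u assume u: "u \<in> (?R \<union> ?C) \<inter> ?E"
    then have "u = v"
      using assms eq_if_row_entry_eq[of u v] eq_if_column_entry_eq[of u v] by blast
    with u show False
      using assms by simp
  qed
  ultimately show ?thesis
    by (simp add: card_Un_disjoint)
qed

section \<open>Transversals, independence and domination\<close>

lemma transversal_iff_inj_on:
  assumes "S \<subseteq> cells n"
  shows "transversal n L S \<longleftrightarrow>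
    card S = n \<and> inj_on fst S \<and> inj_on snd S \<and> inj_on (entry L) S"
\<comment> \<open>For any other cardinality both sides are false.\<close>
proof (cases "card S = n")
  case True
  have "finite S"
    using assms finite_cells finite_subset by blast
  moreover have "card S = card {1..n}"
    using True by simp
  ultimately have iff: "inj_on f S \<longleftrightarrow> (\<forall>x\<in>{1..n}. \<exists>!u. u \<in> S \<and> f u = x)"
    if "f ` S \<subseteq> {1..n}" for f
    using that by (intro inj_on_iff_ex1_fibre) auto
  have "fst ` S \<subseteq> {1..n}" "snd ` S \<subseteq> {1..n}" "entry L ` S \<subseteq> {1..n}"
    using assms entry_in_range by (auto simp: cells_def)
  then show ?thesis
    unfolding transversal_def using True assms
    by (simp only: iff simp_thms)
qed (simp add: transversal_def)

text \<open>Adjacent cells of \<open>S\<close> would share a row, column or symbol, against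
  injectivity of that coordinate on \<open>S\<close>.\<close>

lemma independent_if_transversal:
  assumes "S \<subseteq> cells n" "transversal n L S"
  shows "independent_set (latin_square_graph L n) S"
proof -
  have "inj_on fst S" "inj_on snd S" "inj_on (entry L) S"
    using assms transversal_iff_inj_on by auto
  then have "(u, v) \<notin> parcs (latin_square_graph L n)" if "u \<in> S" "v \<in> S" for u v
    using that by (auto simp: arc_latin_square_graph_iff dest: inj_onD)
  moreover have "S \<subseteq> pverts (latin_square_graph L n)"
    using assms(1) by simp
  ultimately show ?thesis
    by (auto simp: independent_set_def)
qed

text \<open>The row, the column and the symbol of a cell outside \<open>S\<close> each supply a
  neighbour in \<open>S\<close>, and the additive count of neighbours shows that these are three
  different cells.\<close>

lemma dominating_if_transversal:
  assumes "S \<subseteq> cells n" "transversal n L S"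
  shows "k_dominating 3 (latin_square_graph L n) S"
proof -
  have "finite S"
    using assms(1) finite_cells finite_subset by blast
  note rows_columns_symbols = assms(2)[unfolded transversal_def, THEN conjunct2, THEN conjunct2]
  note rows = rows_columns_symbols[THEN conjunct1]
    and columns = rows_columns_symbols[THEN conjunct2, THEN conjunct1]
    and symbols = rows_columns_symbols[THEN conjunct2, THEN conjunct2]
  have one: "1 \<le> card (fibre S f x)" if ex: "\<forall>x\<in>B. \<exists>!u. u \<in> S \<and> f u = x" "x \<in> B"
    for f :: "nat \<times> nat \<Rightarrow> nat" and x B
  proof -
    obtain u where "u \<in> S" "f u = x"
      using ex by blast
    then show ?thesis
      using card_fibre_pos[OF \<open>finite S\<close>, of u f] by simp
  qed
  have "3 \<le> card {u \<in> S. (v, u) \<in> parcs (latin_square_graph L n)}" if v: "v \<in> cells n - S" for v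
  proof -
    have range: "fst v \<in> {1..n}" "snd v \<in> {1..n}" "entry L v \<in> {1..n}"
      using v entry_in_range by (auto simp: cells_def)
    have "1 \<le> card (fibre S fst (fst v))" "1 \<le> card (fibre S snd (snd v))"
      "1 \<le> card (fibre S (entry L) (entry L v))"
      by (rule one[OF rows range(1)] one[OF columns range(2)] one[OF symbols range(3)])+
    then show ?thesis
      using card_neighbours[OF assms(1) v] by linarith
  qed
  then show ?thesis
    using assms(1) by (simp add: k_dominating_def)
qed

lemma transversal_if_dominating:
  assumes S: "S \<subseteq> cells n"
    and dom: "k_dominating 3 (latin_square_graph L n) S" and card: "card S = n"
  shows "transversal n L S"
proof -
  define r :: "nat \<times> nat \<Rightarrow> nat" where "r v = card (fibre S fst (fst v))" for v
  define c :: "nat \<times> nat \<Rightarrow> nat" where "c v = card (fibre S snd (snd v))" for v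
  define s where "s v = card (fibre S (entry L) (entry L v))" for v
  have fin: "finite S"
    using S finite_cells finite_subset by blast
  have pos: "1 \<le> r v" "1 \<le> c v" "1 \<le> s v" if "v \<in> S" for v
    unfolding r_def c_def s_def by (rule card_fibre_pos[OF fin that])+
  have ge: "3 \<le> r v + c v + s v" if "v \<in> cells n" for v
  proof (cases "v \<in> S")
    case True
    then show ?thesis using pos[of v] by linarith
  next
    case False
    then have v: "v \<in> cells n - S"
      using that by blast
    then have "3 \<le> card {u \<in> S. (v, u) \<in> parcs (latin_square_graph L n)}"
      using dom by (simp add: k_dominating_def)
    then show ?thesis
      using card_neighbours[OF S v] by (simp add: r_def c_def s_def)
  qed
  have range: "fst u \<in> {1..n}" "snd u \<in> {1..n}" "entry L u \<in> {1..n}" if "u \<in> S" for u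
    using S that entry_in_range[of u] by (auto simp: cells_def)
  have "sum r (cells n) = n * n" "sum c (cells n) = n * n" "sum s (cells n) = n * n"
    unfolding r_def c_def s_def
    \<comment> \<open>Each row, column and symbol class has \<open>n\<close> cells, so each sum is
      \<open>n * card S\<close>.\<close>
    using sum_card_fibre[OF finite_cells S card_fst_fibre[OF range(1)]]
      sum_card_fibre[OF finite_cells S card_snd_fibre[OF range(2)]]
      sum_card_fibre[OF finite_cells S card_entry_fibre[OF range(3)]]
    unfolding card by simp_all
  then have total: "(\<Sum>v\<in>cells n. 3) = (\<Sum>v\<in>cells n. r v + c v + s v)"
    by (simp add: sum.distrib card_cells)
  have "3 = r v + c v + s v" if "v \<in> cells n" for v
    \<comment> \<open>Termwise inequality between equal finite sums forces equality of every
      term.\<close>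
    using sum_mono_inv[OF total ge that finite_cells] by simp
  then have eq: "3 = r v + c v + s v" if "v \<in> S" for v
    using S that by blast
  \<comment> \<open>Three positive integers with sum 3 are all 1.\<close>
  have "r v = 1 \<and> c v = 1 \<and> s v = 1" if "v \<in> S" for v
    using pos[OF that] eq[OF that] by linarith
  then show ?thesis
    using S card fin by (simp add: transversal_iff_inj_on inj_on_iff_card_fibre r_def c_def s_def)
qed

end

theorem theorem2p1:
  fixes n :: nat and L :: "nat \<Rightarrow> nat \<Rightarrow> nat" and S :: "(nat \<times> nat) set"
  assumes "latin_square n L"
    and "S \<subseteq> pverts (latin_square_graph L n)"
  shows "(k_dominating 3 (latin_square_graph L n) S \<and> card S = n \<longleftrightarrow>
          one_k_independent_dominating 3 (latin_square_graph L n) S \<and> card S = n) \<and>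
         (one_k_independent_dominating 3 (latin_square_graph L n) S \<and> card S = n \<longleftrightarrow>
          transversal n L S)"
proof -
  have S: "S \<subseteq> cells n"
    using assms(2) by simp
  have "card S = n" if "transversal n L S"
    using that by (simp add: transversal_def)
  \<comment> \<open>Counting leads from domination to a transversal, and a transversal is
    dominating, independent and of size \<open>n\<close>. The remaining implication just drops
    independence.\<close>
  then show ?thesis
    using transversal_if_dominating[OF assms(1) S] dominating_if_transversal[OF assms(1) S]
      independent_if_transversal[OF assms(1) S]
    unfolding one_k_independent_dominating_def by argo
qed

end
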